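(* Let $R_n$ be the ring graph with vertex set $V=\{1,\dots,n\}$ and edge set $\{(1,2),\dots,(n-1,n),(n,1)\}$. For the rumor propagation process on $R_n$ started from the configuration in which each site knows a different information, $$\frac{\mathbb{E}\,\tau_V}{\mathbb{E}\,\tau_1}\longrightarrow 1\qquad\text{as } n\to\infty .$$
   Context: Rumor propagation process on a finite graph $G=(V,E)$ with $|V|=n$: $i_x(t)\subset I_n=\{1,\dots,n\}$ denotes the set of informations known by site $x$ at time $t\in\{0,1,2,\dots\}$. At each time $t$ an edge $e_{xy}\in E$ (joining $x$ and $y$) is selected uniformly at random from $E$, independently of the past, and then $i_x(t+1)=i_y(t+1)=i_x(t)\cup i_y(t)$, while $i_z(t+1)=i_z(t)$ for $z\ne x,y$. Here the initial configuration is $i_k(0)=\{k\}$ for each site $k\in\{1,\dots,n\}$. For $H\subset I_n$ the propagation time is $\tau_H=\inf\{t: H\subset i_x(t)\text{ for all }x\in V\}$; $\tau_V=\tau_{I_n}$ is the total propagation time, and $\tau_1=\tau_{\{1\}}$ is the propagation time of the information initially known by site $1$. *)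

theory Defs
  imports "HOL-Probability.Probability"
begin

text \<open>
  Edges are unordered, i.e. two-element vertex sets, and each information is named by the
  site that knows it at time 0.  The argument \<open>\<omega>\<close> is the sequence of selected
  edges, \<open>\<omega> t\<close> being the one selected at time \<open>t\<close>.
\<close>

primrec informations :: "(nat \<Rightarrow> 'v set) \<Rightarrow> nat \<Rightarrow> 'v \<Rightarrow> 'v set" where
  "informations \<omega> 0 x = {x}"
| "informations \<omega> (Suc t) x =
     (if x \<in> \<omega> t then \<Union>y\<in>\<omega> t. informations \<omega> t y else informations \<omega> t x)"

text \<open>The value is \<open>\<infinity>\<close> if \<open>H\<close> never becomes known to all sites.\<close>

definition propagation_time :: "'v set \<Rightarrow> 'v set \<Rightarrow> (nat \<Rightarrow> 'v set) \<Rightarrow> enat" where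
  "propagation_time V H \<omega> = Inf {enat t | t. \<forall>x\<in>V. H \<subseteq> informations \<omega> t x}"

definition edge_selection :: "'v set set \<Rightarrow> (nat \<Rightarrow> 'v set) measure" where
  "edge_selection E = (\<Pi>\<^sub>M t\<in>UNIV. uniform_count_measure E)"

definition expected_propagation_time :: "'v set \<Rightarrow> 'v set set \<Rightarrow> 'v set \<Rightarrow> ennreal" where
  "expected_propagation_time V E H =
     (\<integral>\<^sup>+ \<omega>. ennreal_of_enat (propagation_time V H \<omega>) \<partial>edge_selection E)"

text \<open>This is the ring graph for \<open>n \<ge> 3\<close>; smaller \<open>n\<close> are degenerate.\<close>

definition ring_vertices :: "nat \<Rightarrow> nat set" where
  "ring_vertices n = {1..n}"

definition ring_edges :: "nat \<Rightarrow> nat set set" where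
  "ring_edges n = insert {n, 1} {{k, k + 1} | k. 1 \<le> k \<and> k < n}"

end

theory Submission
  imports Defs "HOL-Real_Asymp.Real_Asymp"
begin

text \<open>
  On the ring, the set of sites that know a given information is an arc, and an arc that is not
  the whole ring has exactly two boundary edges.  So in each step it grows by one site with
  probability \<open>p = 2/n\<close>, and the time for one information to reach everybody is a sum of
  \<open>n - 1\<close> geometric variables of mean \<open>n/2\<close>; its expectation is
  \<open>n(n - 1)/2\<close>.

  The total propagation time is the maximum of \<open>n\<close> such (dependent) times, hence has at
  least that expectation.  Conversely each of them has exponentially small upper tails: for
  \<open>x \<ge> 1\<close>, the quantity \<open>x\<close> to the number of uninformed sites shrinks on average
  by the factor \<open>q = 1 - p + p/x\<close> in each step as long as that number is positive, so the
  time exceeds \<open>t\<close> with probability at most \<open>x\<^sup>n q\<^sup>t\<close>.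
  With \<open>x = 1 + \<delta>\<close> and \<open>t\<close> at least \<open>(1 + \<delta>)\<^sup>2 n\<^sup>2/2\<close>,
  this is at most \<open>exp (- \<delta>\<^sup>2 n)\<close>, which beats the factor \<open>n\<close> of the union
  bound.  Letting \<open>\<delta>\<close> tend to 0 slowly, e.g. \<open>\<delta> = n powr (- 1 / 4)\<close>, gives
  \<open>n\<^sup>2/2 + o(n\<^sup>2)\<close> for the expected total time as well.

  The lemmas that carry this are \<open>unreached_prob_Suc\<close> (conditioning on the first selected
  edge), \<open>infect_arc\<close> (the geometry of the ring), \<open>unreached_prob_arc\<close>, which combines
  the two into an explicit recursion for the survival probabilities, \<open>survival_sums\<close> and
  \<open>survival_le\<close>, which evaluate and bound that recursion, and
  \<open>expected_propagation_time_union_bound\<close>.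
\<close>

section \<open>The spread of one information\<close>

definition infect :: "'v set \<Rightarrow> 'v set \<Rightarrow> 'v set" where
  "infect A e = (if e \<inter> A = {} then A else A \<union> e)"

text \<open>
  An arbitrary initial set is allowed so that the process can be restarted after its first step.
\<close>

primrec informed :: "'v set \<Rightarrow> (nat \<Rightarrow> 'v set) \<Rightarrow> nat \<Rightarrow> 'v set" where
  "informed A \<omega> 0 = A"
| "informed A \<omega> (Suc t) = infect (informed A \<omega> t) (\<omega> t)"

lemma informed_singleton: "informed {k} \<omega> t = {x. k \<in> informations \<omega> t x}"
  by (induction t) (auto simp: infect_def)

text \<open>
  Moving the first edge into the initial set is what makes conditioning on that edge yield a
  recursion: the remaining edges again form a sequence of independent uniform edges.
\<close>

lemma informed_case_nat: "informed A (case_nat e \<omega>) (Suc t) = informed (infect A e) \<omega> t"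
  by (induction t) auto

lemma informations_mono:
  assumes "s \<le> t"
  shows "informations \<omega> s x \<subseteq> informations \<omega> t x"
  using assms by (induction rule: dec_induct) auto

text \<open>
  Knowledge is never lost, so the propagation time exceeds \<open>t\<close> precisely if the propagation is
  unfinished at time \<open>t\<close>; the informations in \<open>H\<close> can then be followed one by one.
\<close>

lemma less_propagation_time_iff:
  "enat t < propagation_time V H \<omega> \<longleftrightarrow> (\<exists>k\<in>H. \<not> V \<subseteq> informed {k} \<omega> t)"
proof -
  let ?done = "\<lambda>s. \<forall>x\<in>V. H \<subseteq> informations \<omega> s x"
  have "enat t < propagation_time V H \<omega> \<longleftrightarrow> \<not> ?done t"
  proof
    assume less: "enat t < propagation_time V H \<omega>"
    show "\<not> ?done t"
    proof
      assume "?done t"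
      then have "enat t \<in> {enat t | t. ?done t}"
        by simp
      then have "propagation_time V H \<omega> \<le> enat t"
        unfolding propagation_time_def by (rule Inf_lower)
      with less show False by (simp add: leD)
    qed
  next
    assume not_done: "\<not> ?done t"
    have "enat (Suc t) \<le> propagation_time V H \<omega>"
      unfolding propagation_time_def
    proof (rule Inf_greatest, safe)
      fix s assume "?done s"
      have "?done t" if "s \<le> t"
        using \<open>?done s\<close> informations_mono[OF that] by (meson subset_trans)
      then have "\<not> s \<le> t"
        using not_done by (rule contrapos_nn[rotated])
      then show "enat (Suc t) \<le> enat s" by simp
    qed
    then show "enat t < propagation_time V H \<omega>"
      by (simp add: Suc_ile_eq)
  qed
  then show ?thesis
    by (auto simp: informed_singleton)
qed

section \<open>Expected times as sums of survival probabilities\<close>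

definition unreached_prob :: "'v set \<Rightarrow> 'v set set \<Rightarrow> 'v set \<Rightarrow> nat \<Rightarrow> ennreal" where
  "unreached_prob V E A t =
     emeasure (edge_selection E) {\<omega> \<in> space (edge_selection E). \<not> V \<subseteq> informed A \<omega> t}"

lemma measurable_selected_edge:
  "(\<lambda>\<omega>. \<omega> t) \<in> measurable (edge_selection E) (count_space E)"
proof -
  have "(\<lambda>\<omega>. \<omega> t) \<in> measurable (edge_selection E) (uniform_count_measure E)"
    unfolding edge_selection_def by (rule measurable_component_singleton) simp
  also have "measurable (edge_selection E) (uniform_count_measure E)
      = measurable (edge_selection E) (count_space E)"
    by (rule measurable_cong_sets) (simp_all add: sets_uniform_count_measure)
  finally show ?thesis .
qed

text \<open>
  The selected edge takes only finitely many values, so no structure on the sets of sites is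
  needed: for each value of the edge, the next set is a function of the previous one.
\<close>

lemma measurable_informed:
  assumes "finite E"
  shows "(\<lambda>\<omega>. informed A \<omega> t) \<in> measurable (edge_selection E) (count_space UNIV)"
proof (induction t)
  case (Suc t)
  have "(\<lambda>\<omega>. infect (informed A \<omega> t) e) \<in> measurable (edge_selection E) (count_space UNIV)" for e
    by (rule measurable_compose[OF Suc.IH]) simp
  then show ?case
    unfolding informed.simps
    by (rule measurable_compose_countable'[where f = "\<lambda>e \<omega>. infect (informed A \<omega> t) e",
          OF _ measurable_selected_edge countable_finite[OF assms]])
qed simp

lemma unreached_event_measurable:
  assumes "finite E"
  shows "{\<omega> \<in> space (edge_selection E). \<not> V \<subseteq> informed A \<omega> t} \<in> sets (edge_selection E)"
proof -
  have "{\<omega> \<in> space (edge_selection E). \<not> V \<subseteq> informed A \<omega> t}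
      = (\<lambda>\<omega>. informed A \<omega> t) -` {B. \<not> V \<subseteq> B} \<inter> space (edge_selection E)"
    by auto
  then show ?thesis
    using measurable_sets[OF measurable_informed[OF assms], of "{B. \<not> V \<subseteq> B}"] by simp
qed

lemma propagation_time_measurable:
  assumes "finite E" "finite H"
  shows "propagation_time V H \<in> measurable (edge_selection E) (count_space UNIV)"
proof -
  have less_sets:
    "{\<omega> \<in> space (edge_selection E). enat t < propagation_time V H \<omega>} \<in> sets (edge_selection E)"
    for t
  proof -
    have "{\<omega> \<in> space (edge_selection E). enat t < propagation_time V H \<omega>}
        = (\<Union>k\<in>H. {\<omega> \<in> space (edge_selection E). \<not> V \<subseteq> informed {k} \<omega> t})"
      by (auto simp: less_propagation_time_iff)
    then show ?thesis
      using assms by (auto intro!: sets.finite_UN unreached_event_measurable)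
  qed
  (* As a supremum of countably many functions of these events, the time inherits measurability;
     countability of enat is what makes the discrete target unproblematic. *)
  have "propagation_time V H
      = (\<lambda>\<omega>. SUP t. if enat t < propagation_time V H \<omega> then enat (Suc t) else 0)"
  proof
    fix \<omega> :: "nat \<Rightarrow> 'a set"
    show "propagation_time V H \<omega> = (SUP t. if enat t < propagation_time V H \<omega> then enat (Suc t) else 0)"
    proof (rule antisym)
      show "(SUP t. if enat t < propagation_time V H \<omega> then enat (Suc t) else 0)
          \<le> propagation_time V H \<omega>"
        by (rule SUP_least) (simp add: Suc_ile_eq)
      show "propagation_time V H \<omega>
          \<le> (SUP t. if enat t < propagation_time V H \<omega> then enat (Suc t) else 0)" (is "_ \<le> ?S")
      proof (rule ccontr)
        assume "\<not> propagation_time V H \<omega> \<le> ?S"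
        then have less: "?S < propagation_time V H \<omega>" by simp
        then obtain s where s: "?S = enat s" by (cases ?S) auto
        then have "enat (Suc s) \<le> ?S"
          using less SUP_upper[of s UNIV
            "\<lambda>t. if enat t < propagation_time V H \<omega> then enat (Suc t) else 0"] by simp
        then show False using s by simp
      qed
    qed
  qed
  also have "\<dots> \<in> measurable (edge_selection E) (count_space UNIV)"
    by (intro measurable_SUP measurable_If measurable_const less_sets) simp_all
  finally show ?thesis .
qed

lemma expected_propagation_time_eq_suminf:
  assumes "finite E" "finite H"
  shows "expected_propagation_time V E H =
    (\<Sum>t. emeasure (edge_selection E)
            (\<Union>k\<in>H. {\<omega> \<in> space (edge_selection E). \<not> V \<subseteq> informed {k} \<omega> t}))"
proof -
  have "{\<omega> \<in> space (edge_selection E). enat t < propagation_time V H \<omega>}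
      = (\<Union>k\<in>H. {\<omega> \<in> space (edge_selection E). \<not> V \<subseteq> informed {k} \<omega> t})" for t
    by (auto simp: less_propagation_time_iff)
  then show ?thesis
    unfolding expected_propagation_time_def
    by (subst nn_integral_enat_function[OF propagation_time_measurable[OF assms]]) simp
qed

lemma expected_propagation_time_singleton:
  assumes "finite E"
  shows "expected_propagation_time V E {k} = (\<Sum>t. unreached_prob V E {k} t)"
  using assms by (simp add: expected_propagation_time_eq_suminf unreached_prob_def)

lemma prob_space_edge_selection:
  assumes "finite E" "E \<noteq> {}"
  shows "prob_space (edge_selection E)"
  unfolding edge_selection_def
  using assms by (intro prob_space_PiM prob_space_uniform_count_measure)

text \<open>
  The trivial bound 1 is kept because the union bound is useless before the typical
  propagation time, when the sum over \<open>H\<close> is close to \<open>card H\<close>.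
\<close>

lemma expected_propagation_time_union_bound:
  assumes "finite E" "E \<noteq> {}" "finite H"
  shows "expected_propagation_time V E H \<le> (\<Sum>t. min 1 (\<Sum>k\<in>H. unreached_prob V E {k} t))"
proof -
  interpret prob_space "edge_selection E"
    using assms by (intro prob_space_edge_selection)
  show ?thesis
    unfolding expected_propagation_time_eq_suminf[OF assms(1,3)] unreached_prob_def
    by (intro suminf_le summableI min.boundedI emeasure_le_1 emeasure_subadditive_finite)
      (auto simp: assms intro!: unreached_event_measurable)
qed

lemma expected_propagation_time_mono:
  assumes "H \<subseteq> K"
  shows "expected_propagation_time V E H \<le> expected_propagation_time V E K"
  unfolding expected_propagation_time_def propagation_time_def
  using assms by (intro nn_integral_mono) (auto intro!: Inf_superset_mono)

section \<open>First-step recursion\<close>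

lemma unreached_prob_0:
  assumes "finite E" "E \<noteq> {}"
  shows "unreached_prob V E A 0 = (if V \<subseteq> A then 0 else 1)"
proof -
  interpret prob_space "edge_selection E"
    using assms by (rule prob_space_edge_selection)
  show ?thesis
    using emeasure_space_1 by (simp add: unreached_prob_def)
qed

text \<open>
  A sequence of independent edges is one edge followed by an independent copy of the
  sequence, so Fubini's theorem conditions on the first edge.
\<close>

lemma unreached_prob_Suc:
  assumes "finite E" "E \<noteq> {}"
  shows "unreached_prob V E A (Suc t) =
    (\<Sum>e\<in>E. ennreal (1 / card E) * unreached_prob V E (infect A e) t)"
proof -
  let ?M = "uniform_count_measure E"
  interpret prob_space ?M
    using assms by (rule prob_space_uniform_count_measure)
  interpret S: sequence_space ?M ..
  have S: "S.S = edge_selection E"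
    by (simp add: edge_selection_def)
  let ?X = "\<lambda>A t. {\<omega> \<in> space (edge_selection E). \<not> V \<subseteq> informed A \<omega> t}"
  have X: "?X A t \<in> sets (edge_selection E)" for A t
    using assms(1) by (rule unreached_event_measurable)
  define f :: "(nat \<Rightarrow> 'a set) \<Rightarrow> ennreal" where "f = indicator (?X A (Suc t))"
  have [measurable]: "f \<in> borel_measurable S.S"
    unfolding f_def S using X by (rule borel_measurable_indicator)
  have "unreached_prob V E A (Suc t) = (\<integral>\<^sup>+\<omega>. f \<omega> \<partial>S.S)"
    using X by (simp add: unreached_prob_def S f_def del: informed.simps)
  also have "\<dots> = (\<integral>\<^sup>+z. f ((\<lambda>(e, \<omega>). case_nat e \<omega>) z) \<partial>(?M \<Otimes>\<^sub>M S.S))"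
    by (subst S.PiM_iter[symmetric]) (simp add: nn_integral_distr)
  also have "\<dots> = (\<integral>\<^sup>+e. \<integral>\<^sup>+\<omega>. f (case_nat e \<omega>) \<partial>S.S \<partial>?M)"
    by (subst S.P.nn_integral_fst[symmetric]) simp_all
  also have "\<dots> = (\<integral>\<^sup>+e. unreached_prob V E (infect A e) t \<partial>?M)"
  proof (rule nn_integral_cong)
    fix e assume e: "e \<in> space ?M"
    have "(\<integral>\<^sup>+\<omega>. f (case_nat e \<omega>) \<partial>S.S)
        = (\<integral>\<^sup>+\<omega>. indicator (?X (infect A e) t) \<omega> \<partial>S.S)"
    proof (rule nn_integral_cong)
      fix \<omega> assume "\<omega> \<in> space S.S"
      moreover have "case_nat e \<omega> \<in> space S.S \<longleftrightarrow> \<omega> \<in> space S.S"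
        using e by (auto simp: space_PiM PiE_iff split: nat.split)
      ultimately show "f (case_nat e \<omega>) = indicator (?X (infect A e) t) \<omega>"
        by (simp add: f_def S indicator_def informed_case_nat del: informed.simps)
    qed
    then show "(\<integral>\<^sup>+\<omega>. f (case_nat e \<omega>) \<partial>S.S) = unreached_prob V E (infect A e) t"
      using X by (simp add: unreached_prob_def S)
  qed
  also have "\<dots> = (\<Sum>e\<in>E. ennreal (1 / card E) * unreached_prob V E (infect A e) t)"
    unfolding uniform_count_measure_def
    using assms(1) by (rule nn_integral_point_measure_finite)
  finally show ?thesis .
qed

section \<open>Arcs of the ring\<close>

text \<open>
  Sites are indexed by all integers, periodically, so that an arc is the image of an
  interval also when it passes from site \<open>n\<close> to site 1.
\<close>

definition ring_site :: "nat \<Rightarrow> int \<Rightarrow> nat" where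
  "ring_site n i = nat (i mod int n) + 1"

definition ring_arc :: "nat \<Rightarrow> int \<Rightarrow> nat \<Rightarrow> nat set" where
  "ring_arc n a m = ring_site n ` {a..<a + int m}"

lemma ring_site_eq_iff:
  assumes "n > 0"
  shows "ring_site n i = ring_site n j \<longleftrightarrow> i mod int n = j mod int n"
  using assms by (auto simp: ring_site_def eq_nat_nat_iff)

lemma inj_on_ring_site:
  assumes "n > 0"
  shows "inj_on (ring_site n) {a..<a + int n}"
proof (rule inj_onI)
  fix i j assume ij: "i \<in> {a..<a + int n}" "j \<in> {a..<a + int n}" "ring_site n i = ring_site n j"
  then have "int n dvd i - j"
    using assms by (simp add: ring_site_eq_iff mod_eq_dvd_iff)
  moreover have "\<bar>i - j\<bar> < int n"
    using ij by auto
  ultimately show "i = j"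
    using zdvd_imp_le[of "int n" "\<bar>i - j\<bar>"] by auto
qed

lemma arc_full:
  assumes "n > 0"
  shows "ring_arc n a n = ring_vertices n"
proof -
  have "ring_arc n a n \<subseteq> ring_vertices n"
    using assms by (auto simp: ring_arc_def ring_vertices_def ring_site_def nat_less_iff Suc_le_eq)
  moreover have "card (ring_arc n a n) = n"
    unfolding ring_arc_def using assms by (simp add: card_image inj_on_ring_site)
  ultimately show ?thesis
    by (simp add: card_subset_eq ring_vertices_def)
qed

lemma ring_vertices_subset_arc_iff:
  assumes "n > 0" "m \<le> n"
  shows "ring_vertices n \<subseteq> ring_arc n a m \<longleftrightarrow> m = n"
proof
  assume "ring_vertices n \<subseteq> ring_arc n a m"
  then have "card (ring_vertices n) \<le> card (ring_arc n a m)"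
    by (rule card_mono[rotated]) (simp add: ring_arc_def)
  also have "\<dots> \<le> m"
    unfolding ring_arc_def using card_image_le[of "{a..<a + int m}" "ring_site n"] by simp
  finally show "m = n"
    using assms by (simp add: ring_vertices_def)
qed (use assms in \<open>simp add: arc_full\<close>)

lemma arc_1: "ring_arc n a 1 = {ring_site n a}"
proof -
  have "{a..<a + 1} = {a}" by auto
  then show ?thesis by (simp add: ring_arc_def)
qed

lemma singleton_eq_arc:
  assumes "k \<in> ring_vertices n"
  shows "{k} = ring_arc n (int k - 1) 1"
  using assms unfolding arc_1 by (auto simp: ring_site_def ring_vertices_def Suc_nat_eq_nat_zadd1)

lemma ring_edge_eq: "ring_site n ` {j, j + 1} = ring_arc n j 2"
proof -
  have "{j..<j + 2} = {j, j + 1}" by auto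
  then show ?thesis by (simp add: ring_arc_def)
qed

lemma ring_arc_of_nat: "ring_arc n (int j) 2 = {j mod n + 1, Suc j mod n + 1}"
proof -
  have site: "ring_site n (int i) = i mod n + 1" for i
    unfolding ring_site_def zmod_int[symmetric] by simp
  have "int j + 1 = int (Suc j)" by simp
  then show ?thesis
    unfolding ring_edge_eq[symmetric] by (simp only: image_insert image_empty site)
qed

text \<open>
  Any window of \<open>n\<close> consecutive integers enumerates the edges as arcs of two sites.  For an
  arc that starts at \<open>a\<close> it is convenient to start the window at \<open>a - 1\<close>, the edge that
  enters the arc.
\<close>

lemma ring_edges_eq:
  assumes "n \<ge> 3"
  shows "ring_edges n = (\<lambda>j. ring_arc n j 2) ` {a..<a + int n}"
proof -
  have "ring_edges n = (\<lambda>j. ring_arc n j 2) ` {0..<int n}"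
  proof -
    have last: "ring_arc n (int (n - 1)) 2 = {n, 1}"
      unfolding ring_arc_of_nat using assms by simp
    have inner: "ring_arc n (int j) 2 = {Suc j, Suc j + 1}" if "j < n - 1" for j
      using that by (simp add: ring_arc_of_nat)
    have "{0..<n} = insert (n - 1) {0..<n - 1}"
      using assms by auto
    then have "{0..<int n} = int ` insert (n - 1) {0..<n - 1}"
      using image_int_atLeastLessThan[of 0 n] by simp
    then have "(\<lambda>j. ring_arc n j 2) ` {0..<int n}
        = insert (ring_arc n (int (n - 1)) 2) ((\<lambda>j. ring_arc n (int j) 2) ` {0..<n - 1})"
      by (simp only: image_image image_insert)
    also have "(\<lambda>j. ring_arc n (int j) 2) ` {0..<n - 1} = (\<lambda>j. {Suc j, Suc j + 1}) ` {0..<n - 1}"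
      by (rule image_cong[OF refl]) (simp only: inner atLeastLessThan_iff)
    also have "\<dots> = (\<lambda>k. {k, k + 1}) ` {Suc 0..<Suc (n - 1)}"
      unfolding image_Suc_atLeastLessThan[symmetric] image_image by (rule refl)
    also have "{Suc 0..<Suc (n - 1)} = {k. 1 \<le> k \<and> k < n}"
      using assms by auto
    finally show ?thesis
      unfolding ring_edges_def last by (simp only: setcompr_eq_image)
  qed
  also have "\<dots> = (\<lambda>j. ring_arc n j 2) ` {a..<a + int n}"
  proof -
    have periodic: "ring_arc n (j mod int n) 2 = ring_arc n j 2" for j
      by (simp add: ring_edge_eq[symmetric] ring_site_def mod_add_left_eq)
    have "(\<lambda>j. j mod int n) ` {a..<a + int n} = {0..<int n}"
    proof (rule set_eqI)
      fix i show "i \<in> (\<lambda>j. j mod int n) ` {a..<a + int n} \<longleftrightarrow> i \<in> {0..<int n}"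
      proof
        assume i: "i \<in> {0..<int n}"
        have "a + (i - a) mod int n \<in> {a..<a + int n}" using assms by simp
        moreover have "(a + (i - a) mod int n) mod int n = i"
          using i by (simp add: mod_add_right_eq)
        ultimately show "i \<in> (\<lambda>j. j mod int n) ` {a..<a + int n}"
          by (intro image_eqI[where x = "a + (i - a) mod int n"]) (simp_all only:)
      qed (use assms in auto)
    qed
    then have "(\<lambda>j. ring_arc n j 2) ` {0..<int n}
        = (\<lambda>j. ring_arc n j 2) ` (\<lambda>j. j mod int n) ` {a..<a + int n}"
      by (simp only:)
    then show ?thesis by (simp only: image_image periodic)
  qed
  finally show ?thesis .
qed

text \<open>
  The assumption \<open>n \<ge> 3\<close> excludes that an edge coincides with the same edge read backwards,
  which would force \<open>n\<close> to divide 2.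
\<close>

lemma inj_on_ring_edges:
  assumes "n \<ge> 3"
  shows "inj_on (\<lambda>j. ring_arc n j 2) {a..<a + int n}"
proof (rule inj_onI)
  fix i j assume i: "i \<in> {a..<a + int n}" and j: "j \<in> {a..<a + int n}" and eq: "ring_arc n i 2 = ring_arc n j 2"
  have site: "ring_site n x = ring_site n y \<longleftrightarrow> int n dvd x - y" for x y
    using assms by (simp add: ring_site_eq_iff mod_eq_dvd_iff)
  have "ring_site n i = ring_site n j"
  proof (rule ccontr)
    assume "ring_site n i \<noteq> ring_site n j"
    with eq have "ring_site n (i + 1) = ring_site n j" "ring_site n i = ring_site n (j + 1)"
      by (auto simp: ring_edge_eq[symmetric] doubleton_eq_iff)
    then have "int n dvd (i + 1 - j) - (i - (j + 1))"
      unfolding site by (rule dvd_diff)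
    then have "int n dvd 2" by simp
    then show False using assms zdvd_imp_le[of "int n" 2] by simp
  qed
  then show "i = j"
    using inj_on_ring_site[of n a] i j assms by (auto dest: inj_onD)
qed

text \<open>
  Only the two boundary edges change the arc, each extending it by one site; every other edge
  lies inside the arc or is disjoint from it.  If \<open>m = n - 1\<close>, the boundary edges are still
  different, although they lead to the same site.
\<close>

lemma infect_arc:
  assumes "n \<ge> 3" "1 \<le> m" "m < n" and j: "j \<in> {a - 1..<a - 1 + int n}"
  shows "infect (ring_arc n a m) (ring_arc n j 2) =
    (if j = a - 1 then ring_arc n (a - 1) (Suc m)
     else if j = a + int m - 1 then ring_arc n a (Suc m) else ring_arc n a m)"
proof -
  have overlap: "ring_arc n j 2 \<inter> ring_arc n a m \<noteq> {} \<Longrightarrow> infect (ring_arc n a m) (ring_arc n j 2) = ring_arc n a m \<union> ring_arc n j 2"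
    by (simp add: infect_def)
  have edge: "ring_arc n j 2 = ring_site n ` {j, j + 1}" by (rule ring_edge_eq[symmetric])
  consider "j = a - 1" | "j = a + int m - 1" | "a \<le> j" "j < a + int m - 1" | "a + int m \<le> j"
    using j by (cases "j < a + int m - 1") force+
  then show ?thesis
  proof cases
    case 1
    have "ring_arc n j 2 \<inter> ring_arc n a m \<noteq> {}"
      unfolding edge using assms 1 by (auto simp: ring_arc_def)
    moreover have "ring_arc n a m \<union> ring_arc n j 2 = ring_arc n (a - 1) (Suc m)"
    proof -
      have "{a..<a + int m} \<union> {j, j + 1} = {a - 1..<a - 1 + int (Suc m)}"
        using assms 1 by auto
      then show ?thesis unfolding edge unfolding ring_arc_def image_Un[symmetric] by simp
    qed
    ultimately show ?thesis using 1 overlap by simp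
  next
    case 2
    have "ring_arc n j 2 \<inter> ring_arc n a m \<noteq> {}"
      unfolding edge using assms 2 by (auto simp: ring_arc_def)
    moreover have "ring_arc n a m \<union> ring_arc n j 2 = ring_arc n a (Suc m)"
    proof -
      have "{a..<a + int m} \<union> {j, j + 1} = {a..<a + int (Suc m)}"
        using assms 2 by auto
      then show ?thesis unfolding edge unfolding ring_arc_def image_Un[symmetric] by simp
    qed
    ultimately show ?thesis using 2 assms overlap by simp
  next
    case 3
    then have "ring_arc n j 2 \<subseteq> ring_arc n a m"
      unfolding edge unfolding ring_arc_def by auto
    then show ?thesis using 3 by (auto simp: infect_def)
  next
    case 4
    (* Disjoint index sets have disjoint images because both lie in one period. *)
    have "ring_arc n j 2 \<inter> ring_arc n a m = ring_site n ` ({j, j + 1} \<inter> {a..<a + int m})"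
      unfolding edge unfolding ring_arc_def
      using j 4 assms by (intro inj_on_image_Int[symmetric, OF inj_on_ring_site[of n a]]) auto
    then show ?thesis using 4 assms by (simp add: infect_def)
  qed
qed

section \<open>The number of steps to cover the ring\<close>

text \<open>
  The probability that fewer than \<open>r\<close> of \<open>t\<close> independent trials with success probability
  \<open>p\<close> succeed, i.e. that \<open>r\<close> uninformed sites are not yet exhausted after \<open>t\<close> steps; the
  recursion conditions on the first trial.
\<close>

fun survival :: "real \<Rightarrow> nat \<Rightarrow> nat \<Rightarrow> real" where
  "survival p t 0 = 0"
| "survival p 0 (Suc r) = 1"
| "survival p (Suc t) (Suc r) = (1 - p) * survival p t (Suc r) + p * survival p t r"

lemma survival_nonneg:
  assumes "0 \<le> p" "p \<le> 1"
  shows "0 \<le> survival p t r"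
  using assms by (induction p t r rule: survival.induct) auto

text \<open>
  A Chernoff bound: the right-hand side satisfies the recursion of \<open>survival\<close> with equality
  and dominates its initial values.
\<close>

lemma survival_le:
  assumes "0 \<le> p" "p \<le> 1" "1 \<le> x"
  shows "survival p t r \<le> x ^ r * (1 - p + p / x) ^ t"
  using assms
proof (induction p t r rule: survival.induct)
  case (2 p r)
  then show ?case using one_le_power[of x "Suc r"] by simp
next
  case (3 p t r)
  have "survival p (Suc t) (Suc r)
      \<le> (1 - p) * (x ^ Suc r * (1 - p + p / x) ^ t) + p * (x ^ r * (1 - p + p / x) ^ t)"
    unfolding survival.simps using 3 by (intro add_mono mult_left_mono) auto
  also have "\<dots> = x ^ Suc r * (1 - p + p / x) ^ Suc t"
    using 3 by (simp add: field_simps)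
  finally show ?case .
qed simp

text \<open>
  The sum is the expected number of trials up to the \<open>r\<close>-th success.  Summing the recursion
  over \<open>t\<close> expresses it through the sum for \<open>r - 1\<close>; to solve the resulting linear
  equation the sum has to be finite, which the Chernoff bound (here with \<open>x = 2\<close>) ensures.
\<close>

lemma survival_sums:
  assumes "0 < p" "p \<le> 1"
  shows "(\<lambda>t. survival p t r) sums (r / p)"
proof (induction r)
  case (Suc r)
  have "summable (\<lambda>t. survival p t (Suc r))"
  proof (rule summable_comparison_test')
    show "summable (\<lambda>t. 2 ^ Suc r * (1 - p + p / 2) ^ t)"
      using assms by (intro summable_mult summable_geometric) auto
    show "norm (survival p t (Suc r)) \<le> 2 ^ Suc r * (1 - p + p / 2) ^ t" for t
      using survival_le[of p 2 t "Suc r"] survival_nonneg[of p t "Suc r"] assms by simp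
  qed
  then obtain G where G: "(\<lambda>t. survival p t (Suc r)) sums G"
    by (auto simp: summable_def)
  have "(\<lambda>t. survival p (Suc t) (Suc r)) sums ((1 - p) * G + p * (r / p))"
    unfolding survival.simps by (intro sums_add sums_mult G Suc.IH)
  then have "(\<lambda>t. survival p t (Suc r)) sums ((1 - p) * G + p * (r / p) + 1)"
    by (subst (asm) sums_Suc_iff) simp
  with G have "G = (1 - p) * G + p * (r / p) + 1"
    using sums_unique2 by blast
  then have "G = real (Suc r) / p"
    using assms by (simp add: field_simps)
  with G show ?case by simp
qed simp

text \<open>
  Of the \<open>n\<close> equally likely edges two enlarge the arc, so the first-step recursion for the
  spread is that of \<open>survival\<close> with \<open>p = 2/n\<close>, and depends on the arc only through its size.
\<close>

lemma unreached_prob_arc: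
  assumes n: "n \<ge> 3" and m: "1 \<le> m" "m \<le> n"
  shows "unreached_prob (ring_vertices n) (ring_edges n) (ring_arc n a m) t
    = ennreal (survival (2 / n) t (n - m))"
  using m
proof (induction t arbitrary: a m)
  case 0
  have E: "finite (ring_edges n)" "ring_edges n \<noteq> {}"
    using n by (auto simp: ring_edges_eq[OF n, of 0])
  show ?case
    unfolding unreached_prob_0[OF E]
    using n 0 by (cases "n - m") (auto simp: ring_vertices_subset_arc_iff)
next
  case (Suc t)
  have E: "finite (ring_edges n)" "ring_edges n \<noteq> {}"
    using n by (auto simp: ring_edges_eq[OF n, of 0])
  have card_E: "card (ring_edges n) = n"
    using inj_on_ring_edges[OF n, of 0] by (simp add: ring_edges_eq[OF n, of 0] card_image)
  let ?V = "ring_vertices n" and ?E = "ring_edges n" and ?s = "survival (2 / n) t"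
  have nonneg: "0 \<le> ?s r" for r
    using n by (intro survival_nonneg) auto
  show ?case
  proof (cases "m = n")
    case True
    have "infect ?V e = ?V" if "e \<in> ?E" for e
      using that n unfolding infect_def ring_edges_def ring_vertices_def by auto
    then show ?thesis
      using Suc.IH[of m a] Suc.prems True n by (simp add: unreached_prob_Suc[OF E] arc_full)
  next
    case False
    then obtain r where r: "n - m = Suc r" "n - Suc m = r"
      using Suc.prems by (metis Suc_diff_Suc le_neq_implies_less)
    define J where "J = {a - 1..<a - 1 + int n}"
    have "unreached_prob ?V ?E (ring_arc n a m) (Suc t)
        = (\<Sum>j\<in>J. ennreal (1 / n) * unreached_prob ?V ?E (infect (ring_arc n a m) (ring_arc n j 2)) t)"
      unfolding unreached_prob_Suc[OF E] card_E
      unfolding ring_edges_eq[OF n, of "a - 1"] J_def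
      by (subst sum.reindex[OF inj_on_ring_edges[OF n]]) (simp only: o_def)
    also have "\<dots> = (\<Sum>j\<in>J. ennreal (1 / n * (if j \<in> {a - 1, a + int m - 1} then ?s r else ?s (Suc r))))"
    proof (rule sum.cong[OF refl])
      fix j assume "j \<in> J"
      then have "unreached_prob ?V ?E (infect (ring_arc n a m) (ring_arc n j 2)) t
          = ennreal (if j \<in> {a - 1, a + int m - 1} then ?s r else ?s (Suc r))"
        using infect_arc[OF n, of m j a] Suc.IH[of "Suc m"] Suc.IH[of m] Suc.prems False r
        by (auto simp: J_def)
      then show "ennreal (1 / n) * unreached_prob ?V ?E (infect (ring_arc n a m) (ring_arc n j 2)) t
          = ennreal (1 / n * (if j \<in> {a - 1, a + int m - 1} then ?s r else ?s (Suc r)))"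
        by (auto simp: ennreal_mult[symmetric] nonneg)
    qed
    also have "\<dots> = ennreal (\<Sum>j\<in>J. 1 / n * (if j \<in> {a - 1, a + int m - 1} then ?s r else ?s (Suc r)))"
      by (rule sum_ennreal) (simp add: nonneg)
    also have "(\<Sum>j\<in>J. 1 / n * (if j \<in> {a - 1, a + int m - 1} then ?s r else ?s (Suc r)))
        = survival (2 / n) (Suc t) (n - m)"
    proof -
      let ?B = "{a - 1, a + int m - 1}"
      have B: "?B \<subseteq> J" "card ?B = 2" "finite J" "card J = n"
        using Suc.prems False n by (auto simp: J_def)
      have "(\<Sum>j\<in>J. if j \<in> ?B then ?s r else ?s (Suc r)) = (\<Sum>j\<in>J - ?B. ?s (Suc r)) + (\<Sum>j\<in>?B. ?s r)"
        by (subst sum.subset_diff[OF B(1,3)]) (intro arg_cong2[of _ _ _ _ "(+)"] sum.cong; auto)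
      also have "\<dots> = (real n - 2) * ?s (Suc r) + 2 * ?s r"
        using B n by (simp add: card_Diff_subset of_nat_diff)
      finally show ?thesis
        unfolding r sum_distrib_left[symmetric] using n by (simp add: field_simps)
    qed
    finally show ?thesis .
  qed
qed

lemma unreached_prob_ring_site:
  assumes "n \<ge> 3" "k \<in> ring_vertices n"
  shows "unreached_prob (ring_vertices n) (ring_edges n) {k} t = ennreal (survival (2 / n) t (n - 1))"
  unfolding singleton_eq_arc[OF assms(2)] using assms by (intro unreached_prob_arc) auto

lemma finite_ring_edges: "finite (ring_edges n)"
  by (simp add: ring_edges_def setcompr_eq_image)

lemma expected_time_one_information:
  assumes "n \<ge> 3"
  shows "expected_propagation_time (ring_vertices n) (ring_edges n) {1} = ennreal (real n * (real n - 1) / 2)"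
proof -
  have "1 \<in> ring_vertices n" using assms by (simp add: ring_vertices_def)
  then have "expected_propagation_time (ring_vertices n) (ring_edges n) {1}
      = (\<Sum>t. ennreal (survival (2 / n) t (n - 1)))"
    using assms by (simp add: expected_propagation_time_singleton finite_ring_edges unreached_prob_ring_site)
  also have "\<dots> = ennreal (real (n - 1) / (2 / n))"
    using assms by (intro suminf_ennreal_eq survival_nonneg survival_sums) auto
  finally show ?thesis using assms by (simp add: mult.commute of_nat_diff)
qed

section \<open>The total propagation time\<close>

text \<open>
  The tail probabilities are bounded by 1 before time \<open>T\<close>, about
  \<open>(1 + \<delta>)\<^sup>2 n\<^sup>2/2\<close>, and by the union bound and \<open>survival_le\<close> from then on.  One factor
  \<open>1 + \<delta>\<close> in \<open>T\<close> compensates the denominator of \<open>1 - q = p \<delta> / (1 + \<delta>)\<close>; the other one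
  leaves the surplus \<open>exp (- \<delta>\<^sup>2 n)\<close>.
\<close>

lemma expected_total_time_le:
  assumes n: "n \<ge> 3" and d: "\<delta> > 0"
  shows "expected_propagation_time (ring_vertices n) (ring_edges n) (ring_vertices n)
    \<le> ennreal ((1 + \<delta>)\<^sup>2 * (real n)\<^sup>2 / 2 + 1 + (real n)\<^sup>2 * (1 + \<delta>) / (2 * \<delta>) * exp (- \<delta>\<^sup>2 * n))"
proof -
  define p where "p = 2 / real n"
  define q where "q = 1 - p + p / (1 + \<delta>)"
  define T where "T = nat \<lceil>(1 + \<delta>)\<^sup>2 * (real n)\<^sup>2 / 2\<rceil>"
  define c where "c = n * (1 + \<delta>) ^ n"
  have p: "0 < p" "p \<le> 1" using n by (auto simp: p_def)
  have q: "1 - q = p * \<delta> / (1 + \<delta>)" using d by (simp add: q_def field_simps)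
  have q01: "0 \<le> q" "q < 1"
  proof -
    show "0 \<le> q" using p d by (simp add: q_def)
    have "0 < 1 - q" unfolding q using p d by simp
    then show "q < 1" by simp
  qed
  have c: "c \<ge> 0" using d by (simp add: c_def)
  have "expected_propagation_time (ring_vertices n) (ring_edges n) (ring_vertices n)
      \<le> (\<Sum>t. min 1 (\<Sum>k\<in>ring_vertices n. unreached_prob (ring_vertices n) (ring_edges n) {k} t))"
    by (rule expected_propagation_time_union_bound)
      (use finite_ring_edges in \<open>auto simp: ring_vertices_def ring_edges_def\<close>)
  also have "\<dots> \<le> (\<Sum>t. ennreal (if t < T then 1 else c * q ^ t))"
  proof (intro suminf_le summableI)
    fix t
    have "(\<Sum>k\<in>ring_vertices n. unreached_prob (ring_vertices n) (ring_edges n) {k} t)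
        = (\<Sum>k\<in>ring_vertices n. ennreal (survival p t (n - 1)))"
      using n by (intro sum.cong refl) (simp add: unreached_prob_ring_site p_def)
    also have "\<dots> = ennreal (n * survival p t (n - 1))"
      using p by (subst sum_ennreal) (simp_all add: survival_nonneg ring_vertices_def)
    also have "\<dots> \<le> ennreal (c * q ^ t)"
    proof (rule ennreal_leI)
      have "survival p t (n - 1) \<le> (1 + \<delta>) ^ (n - 1) * q ^ t"
        unfolding q_def using p d by (intro survival_le) auto
      also have "\<dots> \<le> (1 + \<delta>) ^ n * q ^ t"
        using d q01 by (intro mult_right_mono power_increasing) auto
      finally show "n * survival p t (n - 1) \<le> c * q ^ t"
        unfolding c_def mult.assoc by (intro mult_left_mono) auto
    qed
    finally show "min 1 (\<Sum>k\<in>ring_vertices n. unreached_prob (ring_vertices n) (ring_edges n) {k} t)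
        \<le> ennreal (if t < T then 1 else c * q ^ t)"
      by (auto simp: min.coboundedI1 min.coboundedI2)
  qed
  also have "\<dots> = ennreal (c * q ^ T / (1 - q) + T)"
  proof (rule suminf_ennreal_eq)
    have "(\<lambda>t. c * q ^ T * q ^ t) sums (c * q ^ T * (1 / (1 - q)))"
      using q01 by (intro sums_mult geometric_sums) auto
    then have "(\<lambda>t. if t + T < T then 1 else c * q ^ (t + T)) sums (c * q ^ T / (1 - q))"
      by (simp add: power_add mult_ac)
    then show "(\<lambda>t. if t < T then 1 else c * q ^ t) sums (c * q ^ T / (1 - q) + T)"
      by (subst (asm) sums_iff_shift) simp
  qed (use c q01 in auto)
  also have "\<dots> \<le> ennreal ((1 + \<delta>)\<^sup>2 * (real n)\<^sup>2 / 2 + 1 + (real n)\<^sup>2 * (1 + \<delta>) / (2 * \<delta>) * exp (- \<delta>\<^sup>2 * n))"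
  proof (rule ennreal_leI)
    have T: "(1 + \<delta>)\<^sup>2 * (real n)\<^sup>2 / 2 \<le> T" "T \<le> (1 + \<delta>)\<^sup>2 * (real n)\<^sup>2 / 2 + 1"
    proof -
      have "0 \<le> (1 + \<delta>)\<^sup>2 * (real n)\<^sup>2 / 2" by simp
      then show "(1 + \<delta>)\<^sup>2 * (real n)\<^sup>2 / 2 \<le> T" "T \<le> (1 + \<delta>)\<^sup>2 * (real n)\<^sup>2 / 2 + 1"
        unfolding T_def by linarith+
    qed
    have "q ^ T \<le> exp (- (1 - q)) ^ T"
      using q01 exp_ge_add_one_self[of "- (1 - q)"] by (intro power_mono) auto
    also have "\<dots> = exp (- (T * (1 - q)))"
      by (simp add: exp_of_nat_mult[symmetric] algebra_simps)
    also have "\<dots> \<le> exp (- ((1 + \<delta>)\<^sup>2 * (real n)\<^sup>2 / 2 * (1 - q)))"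
      using T q01 by (simp add: mult_right_mono)
    also have "(1 + \<delta>)\<^sup>2 * (real n)\<^sup>2 / 2 * (1 - q) = (1 + \<delta>) * \<delta> * n"
    proof -
      have "u\<^sup>2 * m\<^sup>2 / 2 * (2 / m * \<delta> / u) = u * \<delta> * m" if "u \<noteq> 0" "m \<noteq> 0" for u m :: real
        using that by (simp add: field_simps power2_eq_square)
      from this[of "1 + \<delta>" "real n"] show ?thesis
        unfolding q p_def using n d by simp
    qed
    finally have qT: "q ^ T \<le> exp (- ((1 + \<delta>) * \<delta> * n))" .
    have "(1 + \<delta>) ^ n \<le> exp \<delta> ^ n"
      using d by (intro power_mono exp_ge_add_one_self) auto
    also have "\<dots> = exp (\<delta> * n)"
      by (simp add: exp_of_nat_mult[symmetric] mult.commute)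
    finally have "(1 + \<delta>) ^ n * q ^ T \<le> exp (\<delta> * n) * exp (- ((1 + \<delta>) * \<delta> * n))"
      using qT q01 by (intro mult_mono) auto
    also have "\<dots> = exp (- \<delta>\<^sup>2 * n)"
      by (simp add: exp_add[symmetric] algebra_simps power2_eq_square)
    finally have "n * ((1 + \<delta>) ^ n * q ^ T) / (1 - q) \<le> n * exp (- \<delta>\<^sup>2 * n) / (1 - q)"
      using q01 by (intro divide_right_mono mult_left_mono) auto
    also have "\<dots> = (real n)\<^sup>2 * (1 + \<delta>) / (2 * \<delta>) * exp (- \<delta>\<^sup>2 * n)"
      unfolding q p_def using n d by (simp add: field_simps power2_eq_square)
    finally show "c * q ^ T / (1 - q) + T
        \<le> (1 + \<delta>)\<^sup>2 * (real n)\<^sup>2 / 2 + 1 + (real n)\<^sup>2 * (1 + \<delta>) / (2 * \<delta>) * exp (- \<delta>\<^sup>2 * n)"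
      using T by (simp add: c_def mult.assoc)
  qed
  finally show ?thesis .
qed

theorem proposition1p3:
  shows "(\<lambda>n. expected_propagation_time (ring_vertices n) (ring_edges n) (ring_vertices n)
            / expected_propagation_time (ring_vertices n) (ring_edges n) {1})
         \<longlonglongrightarrow> 1"
proof (rule tendsto_sandwich)
  let ?total = "\<lambda>n. expected_propagation_time (ring_vertices n) (ring_edges n) (ring_vertices n)"
  let ?one = "\<lambda>n. expected_propagation_time (ring_vertices n) (ring_edges n) {1}"
  (* Any choice with \<delta> n \<rightarrow> 0 for which \<delta> n ^ 2 * n outgrows ln n would do. *)
  define \<delta> where "\<delta> n = real n powr (- 1 / 4)" for n
  define B where "B n = (1 + \<delta> n)\<^sup>2 * n\<^sup>2 / 2 + 1
    + n\<^sup>2 * (1 + \<delta> n) / (2 * \<delta> n) * exp (- (\<delta> n)\<^sup>2 * n)" for n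
  show "eventually (\<lambda>n. 1 \<le> ?total n / ?one n) sequentially"
    using eventually_ge_at_top[of 3]
  proof eventually_elim
    case (elim n)
    have "1 \<in> ring_vertices n" using elim by (simp add: ring_vertices_def)
    then have "?one n \<le> ?total n" by (intro expected_propagation_time_mono) simp
    then have "?one n / ?one n \<le> ?total n / ?one n" by (rule divide_right_mono_ennreal)
    moreover have "?one n / ?one n = 1"
      unfolding expected_time_one_information[OF elim]
      using elim by (intro ennreal_divide_self) auto
    ultimately show ?case by simp
  qed
  show "eventually (\<lambda>n. ?total n / ?one n \<le> ennreal (B n / (real n * (real n - 1) / 2))) sequentially"
    using eventually_ge_at_top[of 3]
  proof eventually_elim
    case (elim n)
    have "\<delta> n > 0" using elim by (simp add: \<delta>_def)
    have "B n \<ge> 0" using \<open>\<delta> n > 0\<close> by (simp add: B_def)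
    have "?total n / ?one n \<le> ennreal (B n) / ennreal (real n * (real n - 1) / 2)"
      unfolding expected_time_one_information[OF elim] B_def
      by (intro divide_right_mono_ennreal expected_total_time_le elim \<open>\<delta> n > 0\<close>)
    also have "\<dots> = ennreal (B n / (real n * (real n - 1) / 2))"
      using elim \<open>B n \<ge> 0\<close> by (intro divide_ennreal) auto
    finally show ?case .
  qed
  show "(\<lambda>n. ennreal (B n / (real n * (real n - 1) / 2))) \<longlonglongrightarrow> 1"
  proof -
    have "(\<lambda>n. B n / (real n * (real n - 1) / 2)) \<longlonglongrightarrow> 1"
      unfolding B_def \<delta>_def by real_asymp
    then have "(\<lambda>n. ennreal (B n / (real n * (real n - 1) / 2))) \<longlonglongrightarrow> ennreal 1"
      by (rule tendsto_ennrealI)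
    then show ?thesis by simp
  qed
qed simp

end
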